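(* Consider a polynomial problem (PP) with only one monomial $\prod_{j\in J}x_j$ of degree greater than one, where $J$ is a set without repeated variables, and assume that every variable of the problem appears in at least one monomial of degree one. Let (LP) be the RLT relaxation with $J$-sets of (PP), with $N^{LP}$ variables and $R^{LP}$ constraints. Let $(\mathrm{LP}_1)$ be the RLT relaxation with $J$-sets of the quadratic problem obtained from (PP) by applying quadrification Scheme 1, with $N^{LP}_1$ variables and $R^{LP}_1$ constraints. If $|J|\geq 4$, then $N^{LP}_1\leq N^{LP}$ and $R^{LP}_1\leq R^{LP}$.
   Context: **Polynomial problem.** (PP) is: minimize $\phi_0(x)$ subject to $\phi_r(x)\ge\beta_r$ for $r=1,\dots,R_1$, $\phi_r(x)=\beta_r$ for $r=R_1+1,\dots,R$, and $x\in\Omega=\{x\in\mathbb{R}^n: 0\le l_j\le x_j\le u_j<\infty,\ j\in N\}$, where $N=\{1,\dots,n\}$ and each $\phi_r$ is a polynomial of degree $\delta_r$. Each monomial $\prod_{j\in J}x_j$ is identified with the multiset $J$ of its variable indices (with repetition); $|J|$ is its size counted with repetition. Unions and inclusions of multisets are taken with multiplicity ($J_1\cup J_2$ is the multiset sum). A monomial appears in (PP) if it occurs in some $\phi_r$, $0\le r\le R$. **$J$-sets.** The $J$-sets of a polynomial problem are the multisets of the monomials of degree greater than one appearing in it that are not strictly contained in the multiset of another monomial appearing in it. **RLT relaxation with $J$-sets.** Given a polynomial problem in variables $y_i$ with bounds $l_i\le y_i\le u_i$, its RLT relaxation with $J$-sets is obtained as follows. For each $J$-set $J$ and all multisets $J_1,J_2$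 with $J_1\cup J_2=J$, add the bound-factor constraint $\prod_{i\in J_1}(y_i-l_i)\prod_{i\in J_2}(u_i-y_i)\ge 0$. Then linearize everything (operator $[\cdot]_L$): replace each monomial of degree greater than one, with multiset $I$, by a new RLT variable $X^{RLT}_I$. (LP) is this relaxation applied directly to (PP). **Scheme 1.** $X^Q_J$ denotes a new variable representing $\prod_{j\in J}x_j$; its bounds are the products of the corresponding bounds of the $x_j$. Every monomial of degree greater than 2 in $\phi_0,\dots,\phi_R$ is replaced by $X^Q_J$. For each monomial $J=\{j_1,\dots,j_{|J|}\}$ (indices listed in nondecreasing order) appearing in (PP) with $|J|>2$, the quadratic constraints $X^Q_{j_1\dots j_k}=X^Q_{j_1\dots j_{k-1}}x_{j_k}$ for $k=|J|,|J|-1,\dots,3$ and $X^Q_{j_1j_2}=x_{j_1}x_{j_2}$ are added. The result is a quadratic problem in the variables $x_j$ and $X^Q$. $(\mathrm{LP}_1)$ is the RLT relaxation with $J$-sets of this quadratic problem; its $J$-sets are all size-two multisets of variables (of the quadratic problem) whose product occurs in that problem. **Counting.** The number of variables counts the $x_j$, the $X^Q$ variables (if any) and the RLT variables. An $X^Q$ variable and an RLT variable are regarded as distinct even if they represent the same product of the $x_j$. An RLT variable is counted for every submultiset of size at least two of a $J$-set (bounds being treated symbolically when expanding bound factors). The number of constraints counts the $R$ (linearized) constraints of (PP), the linearized quadratic constraints of the scheme (if any) and the linearized bound-factor constraints; the box constraints $x\in\Omega$ are not counted. Identical constraints or variables arising several times are counted once. *)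

theory Defs
  imports Complex_Main "HOL-Library.Multiset" "HOL-Library.Poly_Mapping"
begin

section \<open>Polynomial problems\<close>

text \<open>
  A monomial is the multiset of its variables, so a polynomial is a finitely supported map from
  multisets to coefficients. Multiset sum is the addition of exponents, hence the convolution
  product of \<^theory>\<open>HOL-Library.Poly_Mapping\<close> is the usual product of polynomials.
\<close>

type_synonym ('v, 'c) poly = "'v multiset \<Rightarrow>\<^sub>0 'c"

definition pvar :: "'v \<Rightarrow> ('v, 'c::comm_ring_1) poly" where
  "pvar v = Poly_Mapping.single {#v#} 1"

definition pconst :: "'c::comm_ring_1 \<Rightarrow> ('v, 'c) poly" where
  "pconst c = Poly_Mapping.single {#} c"

text \<open>The linear map that sends each monomial \<open>I\<close> to the monomial \<open>f I\<close>.\<close>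

definition map_monomials ::
  "('v multiset \<Rightarrow> 'w multiset) \<Rightarrow> ('v, 'c::comm_ring_1) poly \<Rightarrow> ('w, 'c) poly" where
  "map_monomials f p =
     (\<Sum>I \<in> Poly_Mapping.keys p. Poly_Mapping.single (f I) (Poly_Mapping.lookup p I))"

text \<open>\<open>Geq p b\<close> and \<open>Eq p b\<close> are the constraints \<open>p \<ge> b\<close> and \<open>p = b\<close>, as syntactic objects.\<close>

datatype ('p, 'c) relation = Geq (rel_poly: 'p) 'c | Eq (rel_poly: 'p) 'c

type_synonym ('v, 'c) constr = "(('v, 'c) poly, 'c) relation"

text \<open>
  The constraints form a set, so identical ones are counted once. The box constraints are kept
  apart from them.
\<close>

record (overloaded) ('v, 'c) problem =
  variables :: "'v set"
  lower :: "'v \<Rightarrow> 'c"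
  upper :: "'v \<Rightarrow> 'c"
  objective :: "'v multiset \<Rightarrow>\<^sub>0 'c::zero"
  constraints :: "('v, 'c) constr set"

definition poly_problem ::
  "nat \<Rightarrow> nat \<Rightarrow> nat \<Rightarrow> (nat \<Rightarrow> (nat, real) poly) \<Rightarrow> (nat \<Rightarrow> real) \<Rightarrow> (nat \<Rightarrow> real) \<Rightarrow> (nat \<Rightarrow> real)
     \<Rightarrow> (nat, real) problem" where
  "poly_problem n R\<^sub>1 R \<phi> \<beta> l u =
     \<lparr> variables = {1..n}, lower = l, upper = u, objective = \<phi> 0,
       constraints = {Geq (\<phi> r) (\<beta> r) | r. 1 \<le> r \<and> r \<le> R\<^sub>1}
                   \<union> {Eq (\<phi> r) (\<beta> r) | r. R\<^sub>1 + 1 \<le> r \<and> r \<le> R} \<rparr>"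

definition monomials :: "('v, 'c::zero) problem \<Rightarrow> 'v multiset set" where
  "monomials P = Poly_Mapping.keys (objective P)
     \<union> (\<Union>c \<in> constraints P. Poly_Mapping.keys (rel_poly c))"

definition J_sets :: "('v, 'c::zero) problem \<Rightarrow> 'v multiset set" where
  "J_sets P = {J \<in> monomials P. size J > 1 \<and> (\<forall>I \<in> monomials P. \<not> J \<subset># I)}"


section \<open>RLT relaxation with J-sets\<close>

definition bound_factor ::
  "('v, 'c::comm_ring_1) problem \<Rightarrow> 'v multiset \<Rightarrow> 'v multiset \<Rightarrow> ('v, 'c) poly" where
  "bound_factor P J\<^sub>1 J\<^sub>2 =
     (\<Prod>i \<in># J\<^sub>1. pvar i - pconst (lower P i)) * (\<Prod>i \<in># J\<^sub>2. pconst (upper P i) - pvar i)"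

definition bound_factor_constraints ::
  "('v, 'c::comm_ring_1) problem \<Rightarrow> ('v, 'c) constr set" where
  "bound_factor_constraints P =
     {Geq (bound_factor P J\<^sub>1 J\<^sub>2) 0 | J\<^sub>1 J\<^sub>2. J\<^sub>1 + J\<^sub>2 \<in> J_sets P}"

datatype 'v lp_var = Orig 'v | RLT "'v multiset"

definition linearize_monomial :: "'v multiset \<Rightarrow> 'v lp_var multiset" where
  "linearize_monomial I = (if size I > 1 then {#RLT I#} else image_mset Orig I)"

definition linearize :: "('v, 'c::comm_ring_1) poly \<Rightarrow> ('v lp_var, 'c) poly" where
  "linearize = map_monomials linearize_monomial"

text \<open>\<open>lp_box\<close> contains \<open>(x, a, b)\<close> for every box constraint \<open>a \<le> x \<le> b\<close>.\<close>

record (overloaded) ('v, 'c) linear_program =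
  lp_variables :: "'v set"
  lp_objective :: "'v multiset \<Rightarrow>\<^sub>0 'c::zero"
  lp_constraints :: "('v, 'c) constr set"
  lp_box :: "('v \<times> 'c \<times> 'c) set"

definition rlt_relaxation ::
  "('v, 'c::comm_ring_1) problem \<Rightarrow> ('v lp_var, 'c) linear_program" where
  "rlt_relaxation P =
     \<lparr> lp_variables = Orig ` variables P
         \<union> {RLT I | I. size I \<ge> 2 \<and> (\<exists>J \<in> J_sets P. I \<subseteq># J)},
       lp_objective = linearize (objective P),
       lp_constraints = map_relation linearize id ` (constraints P \<union> bound_factor_constraints P),
       lp_box = {(Orig v, lower P v, upper P v) | v. v \<in> variables P} \<rparr>"

definition num_variables :: "('v, 'c::zero) linear_program \<Rightarrow> nat" where
  "num_variables L = card (lp_variables L)"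

definition num_constraints :: "('v, 'c::zero) linear_program \<Rightarrow> nat" where
  "num_constraints L = card (lp_constraints L)"


section \<open>Symbolic bounds\<close>

text \<open>
  For counting, the bounds are not numbers but indeterminates: two bound-factor constraints that
  happen to coincide for particular values of the bounds (for instance when a lower bound equals
  the upper bound) are still different constraints. Coefficients therefore live in the polynomial
  ring over the reals in the symbols \<open>Lower v\<close> and \<open>Upper v\<close>. The relaxation for given numerical
  bounds is obtained by evaluating these symbols.
\<close>

datatype 'v bound_symbol = Lower 'v | Upper 'v

type_synonym 'v symbolic = "'v bound_symbol multiset \<Rightarrow>\<^sub>0 real"

definition with_symbolic_bounds :: "('v, real) problem \<Rightarrow> ('v, 'v symbolic) problem" where
  "with_symbolic_bounds P =
     \<lparr> variables = variables P,
       lower = (\<lambda>v. pvar (Lower v)), upper = (\<lambda>v. pvar (Upper v)),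
       objective = Poly_Mapping.map pconst (objective P),
       constraints = map_relation (Poly_Mapping.map pconst) pconst ` constraints P \<rparr>"


section \<open>Quadrification Scheme 1\<close>

datatype 'v quad_var = X 'v | XQ "'v multiset"

definition quadrify_monomial :: "'v multiset \<Rightarrow> 'v quad_var multiset" where
  "quadrify_monomial I = (if size I > 2 then {#XQ I#} else image_mset X I)"

definition quadrify :: "('v, 'c::comm_ring_1) poly \<Rightarrow> ('v quad_var, 'c) poly" where
  "quadrify = map_monomials quadrify_monomial"

text \<open>
  \<open>prefix_mset J k\<close> is \<open>{j\<^sub>1, \<dots>, j\<^sub>k}\<close> and \<open>nth_index J k\<close> is \<open>j\<^sub>k\<close> (counting from 1), where
  \<open>j\<^sub>1 \<le> j\<^sub>2 \<le> \<dots>\<close> are the elements of \<open>J\<close>.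
\<close>

definition prefix_mset :: "'v::linorder multiset \<Rightarrow> nat \<Rightarrow> 'v multiset" where
  "prefix_mset J k = mset (take k (sorted_list_of_multiset J))"

definition nth_index :: "'v::linorder multiset \<Rightarrow> nat \<Rightarrow> 'v" where
  "nth_index J k = sorted_list_of_multiset J ! (k - 1)"

definition scheme1_constraints ::
  "'v::linorder multiset \<Rightarrow> ('v quad_var, 'c::comm_ring_1) constr set" where
  "scheme1_constraints J =
     {Eq (pvar (XQ (prefix_mset J k))
           - pvar (XQ (prefix_mset J (k - 1))) * pvar (X (nth_index J k))) 0
       | k. 3 \<le> k \<and> k \<le> size J}
     \<union> {Eq (pvar (XQ (prefix_mset J 2)) - pvar (X (nth_index J 1)) * pvar (X (nth_index J 2))) 0}"

primrec product_bound :: "('v \<Rightarrow> 'c::comm_ring_1) \<Rightarrow> 'v quad_var \<Rightarrow> 'c" where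
  "product_bound b (X v) = b v"
| "product_bound b (XQ J) = (\<Prod>j \<in># J. b j)"

definition scheme1 ::
  "('v::linorder, 'c::comm_ring_1) problem \<Rightarrow> ('v quad_var, 'c) problem" where
  "scheme1 P =
     \<lparr> variables = X ` variables P
         \<union> {XQ (prefix_mset J k) | J k. J \<in> monomials P \<and> size J > 2 \<and> 2 \<le> k \<and> k \<le> size J},
       lower = product_bound (lower P), upper = product_bound (upper P),
       objective = quadrify (objective P),
       constraints = map_relation quadrify id ` constraints P
         \<union> (\<Union>J \<in> {J \<in> monomials P. size J > 2}. scheme1_constraints J) \<rparr>"

end

theory Submission
  imports Defs
begin

text \<open>
  Write \<open>m\<close> for the number of variables in the nonlinear monomial, \<open>v\<close> for the number of variables
  of the problem and \<open>c\<close> for the number of its constraints. The two relaxations differ in how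
  they grow with \<open>m\<close>: exponentially when the RLT is applied directly, linearly after Scheme 1.

  In the direct relaxation the only J-set is \<open>J\<close> itself. Since it has no repeated variables, its
  submultisets are its subsets. Hence there are \<open>v + (2^m - m - 1)\<close> variables
  (\<open>num_variables_single_J_set\<close>). There are \<open>2^m\<close> ways to split \<open>J\<close>, and the resulting bound
  factors are pairwise different and different from the original constraints: when the bounds are
  symbols, the constant term of a bound factor is, up to sign, the product of the lower bounds of
  one part and the upper bounds of the other, from which the split can be read off. As
  linearization identifies no two polynomials, there are exactly \<open>c + 2^m\<close> constraints
  (\<open>num_constraints_single_J_set\<close>).

  Scheme 1 builds the monomial up one factor at a time. This takes \<open>m - 1\<close> new variables and
  \<open>m - 1\<close> equations, each containing one product of two variables, and the J-sets are among these
  products. Each product contributes at most one RLT variable and four bound factors. So there are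
  at most \<open>v + 2 (m - 1)\<close> variables and \<open>c + 5 (m - 1)\<close> constraints (\<open>num_variables_scheme1\<close>,
  \<open>num_constraints_scheme1\<close>). Upper bounds suffice here, so these objects need not be told
  apart.

  What remains is \<open>2 (m - 1) \<le> 2^m - m - 1\<close> and \<open>5 (m - 1) \<le> 2^m\<close>, which hold for \<open>m \<ge> 4\<close>.
\<close>

section \<open>Linearization is injective\<close>

lemma lookup_map_monomials:
  assumes "inj f"
  shows "Poly_Mapping.lookup (map_monomials f p) (f I) = Poly_Mapping.lookup p I"
proof -
  have "Poly_Mapping.lookup (map_monomials f p) (f I)
      = (\<Sum>K \<in> Poly_Mapping.keys p. if K = I then Poly_Mapping.lookup p K else 0)"
    unfolding map_monomials_def
    by (auto simp: lookup_sum lookup_single when_def inj_eq[OF assms] intro!: sum.cong)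
  also have "\<dots> = Poly_Mapping.lookup p I"
    by (simp add: in_keys_iff)
  finally show ?thesis .
qed

lemma inj_map_monomials:
  assumes "inj f"
  shows "inj (map_monomials f :: ('v, 'c::comm_ring_1) poly \<Rightarrow> ('w, 'c) poly)"
proof (rule injI)
  fix p q :: "('v, 'c) poly"
  assume "map_monomials f p = map_monomials f q"
  then show "p = q"
    using lookup_map_monomials[OF assms] by (metis poly_mapping_eqI)
qed

lemma keys_map_monomials: "Poly_Mapping.keys (map_monomials f p) \<subseteq> f ` Poly_Mapping.keys p"
proof -
  have "Poly_Mapping.keys (map_monomials f p)
      \<subseteq> (\<Union>I \<in> Poly_Mapping.keys p. Poly_Mapping.keys (Poly_Mapping.single (f I) (Poly_Mapping.lookup p I)))"
    unfolding map_monomials_def by (rule keys_sum)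
  also have "\<dots> \<subseteq> f ` Poly_Mapping.keys p"
    by auto
  finally show ?thesis .
qed

lemma inj_linearize_monomial: "inj linearize_monomial"
proof (rule injI)
  fix I K :: "'a multiset"
  assume eq: "linearize_monomial I = linearize_monomial K"
  have mixed: "{#RLT L#} \<noteq> image_mset Orig M" for L M :: "'a multiset"
  proof
    assume "{#RLT L#} = image_mset Orig M"
    then have "RLT L \<in># image_mset Orig M"
      by (metis union_single_eq_member)
    then show False
      by auto
  qed
  have "inj (Orig :: 'a \<Rightarrow> 'a lp_var)"
    by (simp add: inj_def)
  then show "I = K"
    using eq mixed mixed[symmetric]
    by (auto simp: linearize_monomial_def split: if_splits dest: multiset.inj_map[THEN injD])
qed

text \<open>
  Because of this, the constraints of a relaxation can be counted before linearization.
\<close>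

lemma inj_linearize_constraint:
  "inj (map_relation linearize id :: ('v, 'c::comm_ring_1) constr \<Rightarrow> ('v lp_var, 'c) constr)"
  unfolding linearize_def
  by (intro relation.inj_map inj_map_monomials inj_linearize_monomial inj_on_id)

section \<open>Bound factors with symbolic bounds\<close>

text \<open>
  Taking the constant term is a ring homomorphism, so the constant term of a bound factor is the
  product of the constant terms of its factors.
\<close>

lemma lookup_times_empty:
  fixes p q :: "('v, 'c::comm_ring_1) poly"
  shows "Poly_Mapping.lookup (p * q) {#} = Poly_Mapping.lookup p {#} * Poly_Mapping.lookup q {#}"
proof -
  have "(Poly_Mapping.lookup p l * (\<Sum>r. Poly_Mapping.lookup q r when {#} = l + r))
      = (Poly_Mapping.lookup p l * Poly_Mapping.lookup q {#} when l = {#})" for l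
    by (cases "l = {#}") (auto simp: when_def)
  then show ?thesis
    by (simp add: lookup_mult)
qed

lemma lookup_prod_mset_empty:
  fixes f :: "'i \<Rightarrow> ('v, 'c::comm_ring_1) poly"
  shows "Poly_Mapping.lookup (\<Prod>i \<in># M. f i) {#} = (\<Prod>i \<in># M. Poly_Mapping.lookup (f i) {#})"
  by (induction M) (auto simp: lookup_times_empty lookup_one)

lemma prod_mset_uminus_pvar:
  "(\<Prod>i \<in># M. - pvar (f i)) = Poly_Mapping.single (image_mset f M) ((- 1) ^ size M)"
  by (induction M) (auto simp: pvar_def mult_single single_uminus[symmetric])

lemma prod_mset_pvar:
  "(\<Prod>i \<in># M. pvar (f i)) = Poly_Mapping.single (image_mset f M) 1"
  by (induction M) (auto simp: pvar_def mult_single)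

text \<open>
  The constant term of \<open>x\<^sub>i - l\<^sub>i\<close> is \<open>- l\<^sub>i\<close> and that of \<open>u\<^sub>i - x\<^sub>i\<close> is \<open>u\<^sub>i\<close>, so
  the constant term of the whole product is a single signed monomial in the bound symbols. It tells
  bound factors apart from one another and from polynomials whose coefficients are numbers.
\<close>

lemma constant_term_bound_factor:
  "Poly_Mapping.keys (Poly_Mapping.lookup (bound_factor (with_symbolic_bounds P) J\<^sub>1 J\<^sub>2) {#})
     = {image_mset Lower J\<^sub>1 + image_mset Upper J\<^sub>2}"
proof -
  have "Poly_Mapping.lookup (bound_factor (with_symbolic_bounds P) J\<^sub>1 J\<^sub>2) {#}
      = (\<Prod>i \<in># J\<^sub>1. - pvar (Lower i)) * (\<Prod>i \<in># J\<^sub>2. pvar (Upper i))"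
    by (simp add: bound_factor_def with_symbolic_bounds_def lookup_times_empty
        lookup_prod_mset_empty lookup_minus pvar_def[where v = "_ :: 'a"] pconst_def lookup_single)
  then show ?thesis
    by (simp add: prod_mset_uminus_pvar prod_mset_pvar mult_single)
qed

lemma bound_symbols_eq_iff:
  "image_mset Lower J\<^sub>1 + image_mset Upper J\<^sub>2 = image_mset Lower K\<^sub>1 + image_mset Upper K\<^sub>2
     \<longleftrightarrow> J\<^sub>1 = K\<^sub>1 \<and> J\<^sub>2 = K\<^sub>2"  (is "?L = ?R")
proof
  \<comment> \<open>Filtering by the kind of symbol recovers the two parts.\<close>
  have sel: "{#b \<in># image_mset Lower A + image_mset Upper B. \<exists>v. b = Lower v#} = image_mset Lower A"
    "{#b \<in># image_mset Lower A + image_mset Upper B. \<exists>v. b = Upper v#} = image_mset Upper B"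
    for A B :: "'a multiset"
    by (simp_all add: filter_mset_image_mset)
  have inj: "inj (Lower :: 'a \<Rightarrow> _)" "inj (Upper :: 'a \<Rightarrow> _)"
    by (simp_all add: inj_def)
  assume ?L
  then have "image_mset Lower J\<^sub>1 = image_mset Lower K\<^sub>1" "image_mset Upper J\<^sub>2 = image_mset Upper K\<^sub>2"
    using sel by metis+
  then show ?R
    using inj by (auto dest: multiset.inj_map[THEN injD])
qed simp

lemma bound_factor_eq_iff:
  "bound_factor (with_symbolic_bounds P) J\<^sub>1 J\<^sub>2 = bound_factor (with_symbolic_bounds P) K\<^sub>1 K\<^sub>2
     \<longleftrightarrow> J\<^sub>1 = K\<^sub>1 \<and> J\<^sub>2 = K\<^sub>2"
  by (metis bound_symbols_eq_iff constant_term_bound_factor singleton_inject)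

lemma keys_map_pconst: "Poly_Mapping.keys (Poly_Mapping.map pconst p) = Poly_Mapping.keys p"
  by (auto simp: in_keys_iff map.rep_eq when_def pconst_def) (metis lookup_single_eq lookup_zero)

lemma rel_poly_map_relation [simp]: "rel_poly (map_relation f g c) = f (rel_poly c)"
  by (cases c) auto

lemma monomials_with_symbolic_bounds: "monomials (with_symbolic_bounds P) = monomials P"
  by (simp add: monomials_def with_symbolic_bounds_def keys_map_pconst)

text \<open>
  The original constraints have numbers as coefficients, whereas the constant term of a bound
  factor contains one bound symbol for each element of its J-set, hence at least two.
\<close>

lemma constraints_disjoint_bound_factors:
  "constraints (with_symbolic_bounds P) \<inter> bound_factor_constraints (with_symbolic_bounds P) = {}"
proof -
  \<comment> \<open>A polynomial with numerical coefficients has a constant term free of bound symbols.\<close>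
  have const_imp_empty: "J\<^sub>1 + J\<^sub>2 = {#}"
    if eq: "Poly_Mapping.map pconst p = bound_factor (with_symbolic_bounds P) J\<^sub>1 J\<^sub>2"
    for p :: "('a, real) poly" and J\<^sub>1 J\<^sub>2
  proof -
    have "Poly_Mapping.keys (Poly_Mapping.lookup (Poly_Mapping.map pconst p :: ('a, 'a symbolic) poly) {#})
        \<subseteq> {{#}}"
      by (auto simp: map.rep_eq when_def pconst_def split: if_splits)
    then show ?thesis
      using constant_term_bound_factor[of P J\<^sub>1 J\<^sub>2] eq by auto
  qed
  have nonempty: "{#} \<notin> J_sets (with_symbolic_bounds P)"
    by (simp add: J_sets_def)
  have False
    if original: "c \<in> constraints (with_symbolic_bounds P)"
      and bound_factor: "c \<in> bound_factor_constraints (with_symbolic_bounds P)" for c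
  proof -
    obtain d where "c = map_relation (Poly_Mapping.map pconst) pconst d"
      using original by (auto simp: with_symbolic_bounds_def)
    then have "rel_poly c = Poly_Mapping.map pconst (rel_poly d)"
      by simp
    moreover obtain J\<^sub>1 J\<^sub>2 where "J\<^sub>1 + J\<^sub>2 \<in> J_sets (with_symbolic_bounds P)"
      and "rel_poly c = bound_factor (with_symbolic_bounds P) J\<^sub>1 J\<^sub>2"
      using bound_factor by (auto simp: bound_factor_constraints_def)
    ultimately show False
      using const_imp_empty nonempty by metis
  qed
  then show ?thesis
    by blast
qed

section \<open>Size of the direct relaxation\<close>

text \<open>
  A multiset without repetition has only submultisets without repetition. This is where the
  distinctness of the variables in the nonlinear monomial enters: it makes the number of RLT
  variables and of bound factors exponential.
\<close>

lemma subseteq_mset_set_iff: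
  assumes "finite A"
  shows "I \<subseteq># mset_set A \<longleftrightarrow> (\<exists>B \<subseteq> A. I = mset_set B)"
proof
  assume sub: "I \<subseteq># mset_set A"
  have "set_mset I \<subseteq> A"
    using sub assms by (metis finite_set_mset_mset_set set_mset_mono)
  moreover have "I = mset_set (set_mset I)"
  proof (rule multiset_eqI)
    fix x
    have "count I x \<le> count (mset_set A) x"
      using sub by (rule mset_subset_eq_count)
    also have "\<dots> \<le> 1"
      by (simp add: count_mset_set')
    finally show "count I x = count (mset_set (set_mset I)) x"
      by (cases "x \<in># I") (auto simp: count_mset_set' not_in_iff le_Suc_eq simp flip: count_greater_zero_iff)
  qed
  ultimately show "\<exists>B \<subseteq> A. I = mset_set B"
    by blast
next
  assume "\<exists>B \<subseteq> A. I = mset_set B"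
  then show "I \<subseteq># mset_set A"
    using assms by (auto intro: subset_imp_msubset_mset_set)
qed

lemma inj_on_mset_set_Pow:
  assumes "finite A"
  shows "inj_on mset_set (Pow A)"
  using assms by (metis PowD finite_set_mset_mset_set inj_onI rev_finite_subset)

text \<open>
  A split of \<open>J\<close> is determined by its first part, an arbitrary subset.
\<close>

lemma bound_factor_constraints_single_J_set:
  assumes "J_sets P = {mset_set J}" and "finite J"
  shows "bound_factor_constraints P
       = (\<lambda>A. Geq (bound_factor P (mset_set A) (mset_set J - mset_set A)) 0) ` Pow J"
proof -
  have "J\<^sub>1 + J\<^sub>2 = mset_set J \<longleftrightarrow> (\<exists>A \<subseteq> J. J\<^sub>1 = mset_set A \<and> J\<^sub>2 = mset_set J - mset_set A)" for J\<^sub>1 J\<^sub>2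
    using subseteq_mset_set_iff[OF \<open>finite J\<close>, of J\<^sub>1]
    by (metis add_diff_cancel_left' mset_subset_eq_add_left subset_mset.add_diff_inverse)
  then show ?thesis
    unfolding bound_factor_constraints_def assms(1) by (auto simp: image_def)
qed

lemma card_large_subsets:
  assumes "finite A"
  shows "card {B. B \<subseteq> A \<and> card B \<ge> 2} = 2 ^ card A - (card A + 1)"
proof -
  have small: "{B. B \<subseteq> A \<and> card B \<le> 1} = insert {} ((\<lambda>a. {a}) ` A)"
    using assms by (auto simp: le_Suc_eq card_1_singleton_iff finite_subset)
  have "card (insert {} ((\<lambda>a. {a}) ` A)) = card A + 1"
    using assms by (subst card_insert_disjoint) (auto simp: card_image)
  moreover have "{B. B \<subseteq> A \<and> card B \<ge> 2} = Pow A - {B. B \<subseteq> A \<and> card B \<le> 1}"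
    by auto
  moreover have "{B. B \<subseteq> A \<and> card B \<le> 1} \<subseteq> Pow A"
    by auto
  ultimately show ?thesis
    using assms small by (simp add: card_Diff_subset card_Pow)
qed

lemma num_variables_single_J_set:
  assumes "J_sets P = {mset_set J}" and "finite J" and "finite (variables P)"
  shows "num_variables (rlt_relaxation P) = card (variables P) + (2 ^ card J - (card J + 1))"
proof -
  let ?large = "{A. A \<subseteq> J \<and> card A \<ge> 2}"
  have "size I \<ge> 2 \<and> (\<exists>K \<in> J_sets P. I \<subseteq># K) \<longleftrightarrow> I \<in> mset_set ` ?large" for I
    unfolding assms(1) by (auto simp: subseteq_mset_set_iff[OF assms(2)])
  then have "{RLT I | I. size I \<ge> 2 \<and> (\<exists>K \<in> J_sets P. I \<subseteq># K)} = (RLT \<circ> mset_set) ` ?large"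
    by (auto simp: image_comp[symmetric])
  moreover have "inj_on (RLT \<circ> mset_set) ?large"
    using inj_on_subset[OF inj_on_mset_set_Pow[OF assms(2)], of ?large]
    by (intro comp_inj_on) (auto intro: inj_onI)
  then have "card ((RLT \<circ> mset_set) ` ?large) = 2 ^ card J - (card J + 1)"
    by (simp only: card_image card_large_subsets[OF assms(2)])
  moreover have "card (Orig ` variables P) = card (variables P)"
    by (simp add: card_image inj_on_def)
  moreover have "Orig ` variables P \<inter> (RLT \<circ> mset_set) ` ?large = {}"
    by auto
  ultimately show ?thesis
    using assms(2,3) by (simp add: num_variables_def rlt_relaxation_def card_Un_disjoint)
qed

lemma num_constraints_single_J_set:
  assumes "J_sets P = {mset_set J}" and "finite J" and "finite (constraints P)"
  shows "num_constraints (rlt_relaxation (with_symbolic_bounds P))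
       = card (constraints (with_symbolic_bounds P)) + 2 ^ card J"
proof -
  let ?P = "with_symbolic_bounds P"
  have J: "J_sets ?P = {mset_set J}"
    using assms(1) by (simp add: J_sets_def monomials_with_symbolic_bounds)
  have fin: "finite (constraints ?P)"
    using assms(3) by (simp add: with_symbolic_bounds_def)
  have "num_constraints (rlt_relaxation ?P) = card (constraints ?P \<union> bound_factor_constraints ?P)"
    by (simp add: num_constraints_def rlt_relaxation_def card_image inj_on_subset[OF inj_linearize_constraint])
  moreover have "constraints ?P \<inter> bound_factor_constraints ?P = {}"
    by (rule constraints_disjoint_bound_factors)
  moreover have "card (bound_factor_constraints ?P) = 2 ^ card J"
    unfolding bound_factor_constraints_single_J_set[OF J assms(2)]
    using assms(2) inj_on_mset_set_Pow[OF assms(2)]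
    by (subst card_image) (auto simp: card_Pow bound_factor_eq_iff inj_on_def)
  moreover have "finite (bound_factor_constraints ?P)"
    unfolding bound_factor_constraints_single_J_set[OF J assms(2)] using assms(2) by simp
  ultimately show ?thesis
    using fin by (simp add: card_Un_disjoint)
qed

section \<open>Size of the relaxation after Scheme 1\<close>

text \<open>
  The products of two variables that occur in the equations of Scheme 1. The first one is
  separate because the prefix of length one is represented by an original variable, not by a new
  one.
\<close>

definition scheme1_products :: "'v::linorder multiset \<Rightarrow> 'v quad_var multiset set" where
  "scheme1_products M =
     insert {#X (nth_index M 1), X (nth_index M 2)#}
       ((\<lambda>k. {#XQ (prefix_mset M (k - 1)), X (nth_index M k)#}) ` {3..size M})"

lemma finite_scheme1_products: "finite (scheme1_products M)"
  by (simp add: scheme1_products_def)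

lemma card_scheme1_products:
  assumes "size M \<ge> 2"
  shows "card (scheme1_products M) \<le> size M - 1"
proof -
  have "card (scheme1_products M)
      \<le> Suc (card ((\<lambda>k. {#XQ (prefix_mset M (k - 1)), X (nth_index M k)#}) ` {3..size M}))"
    unfolding scheme1_products_def by (rule card_insert_le_m1) auto
  also have "\<dots> \<le> Suc (card {3..size M})"
    unfolding Suc_le_mono by (rule card_image_le) simp
  finally show ?thesis
    using assms by simp
qed

lemma card_scheme1_constraints:
  fixes M :: "'v::linorder multiset"
  assumes "size M \<ge> 2"
  shows "finite (scheme1_constraints M :: ('v quad_var, 'c::comm_ring_1) constr set)" (is "finite ?S")
    and "card (scheme1_constraints M :: ('v quad_var, 'c) constr set) \<le> size M - 1"
proof -
  define f :: "nat \<Rightarrow> ('v quad_var, 'c) constr" where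
    "f k = Eq (pvar (XQ (prefix_mset M k))
           - pvar (XQ (prefix_mset M (k - 1))) * pvar (X (nth_index M k))) 0" for k
  define c :: "('v quad_var, 'c) constr" where
    "c = Eq (pvar (XQ (prefix_mset M 2)) - pvar (X (nth_index M 1)) * pvar (X (nth_index M 2))) 0"
  have eq: "scheme1_constraints M = insert c (f ` {3..size M})"
    unfolding scheme1_constraints_def f_def c_def by auto
  then show "finite ?S"
    by simp
  have "card (insert c (f ` {3..size M})) \<le> Suc (card (f ` {3..size M}))"
    by (rule card_insert_le_m1) auto
  also have "\<dots> \<le> Suc (card {3..size M})"
    unfolding Suc_le_mono by (rule card_image_le) simp
  finally show "card ?S \<le> size M - 1"
    using assms eq by simp
qed

lemma keys_scheme1_constraints:
  assumes "c \<in> scheme1_constraints M" and "I \<in> Poly_Mapping.keys (rel_poly c)" and "size I > 1"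
  shows "I \<in> scheme1_products M"
proof -
  have "I \<in> {{#v#}, {#a, b#}}"
    if "I \<in> Poly_Mapping.keys (pvar v - pvar a * pvar b :: ('a quad_var, 'b) poly)" for v a b
    using that keys_diff[of "pvar v :: ('a quad_var, 'b) poly" "pvar a * pvar b"]
    by (auto simp: pvar_def mult_single split: if_splits)
  then show ?thesis
    using assms by (fastforce simp: scheme1_constraints_def scheme1_products_def)
qed

text \<open>
  Scheme 1 replaces the only nonlinear monomial of the problem by a single variable. All
  nonlinearity of the quadratic problem therefore comes from its new equations.
\<close>

lemma monomials_scheme1:
  assumes M: "{I \<in> monomials P. size I > 1} = {M}" and "size M > 2"
    and "I \<in> monomials (scheme1 P)" and "size I > 1"
  shows "I \<in> scheme1_products M"
proof -
  have "size (quadrify_monomial K) \<le> 1" if "K \<in> monomials P" for K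
  proof (cases "size K > 1")
    case True
    then have "K = M"
      using M that by blast
    then show ?thesis
      using \<open>size M > 2\<close> by (simp add: quadrify_monomial_def)
  next
    case False
    then show ?thesis
      by (simp add: quadrify_monomial_def)
  qed
  moreover have "K \<in> quadrify_monomial ` Poly_Mapping.keys p"
    if "K \<in> Poly_Mapping.keys (quadrify p)" for K and p :: "('a, 'b) poly"
    using that keys_map_monomials unfolding quadrify_def by blast
  ultimately have "\<exists>K \<in> monomials P. size K > 2 \<and>
      (\<exists>c \<in> scheme1_constraints K :: ('a quad_var, 'b) constr set. I \<in> Poly_Mapping.keys (rel_poly c))"
    using assms(3,4) by (fastforce simp: monomials_def scheme1_def)
  moreover have "K = M" if "K \<in> monomials P" and "size K > 2" for K
    using M that by fastforce
  ultimately show ?thesis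
    using keys_scheme1_constraints assms(4) by blast
qed

lemma J_sets_scheme1:
  assumes "{I \<in> monomials P. size I > 1} = {M}" and "size M > 2"
  shows "J_sets (scheme1 P) \<subseteq> scheme1_products M"
  using monomials_scheme1[OF assms] by (auto simp: J_sets_def)

lemma scheme1_products_size: "I \<in> scheme1_products M \<Longrightarrow> size I = 2"
  by (auto simp: scheme1_products_def)

text \<open>
  A J-set of size two has itself as its only submultiset of size at least two, so it brings in
  only one RLT variable. Besides, there is one new variable for
  each of the \<open>size M - 1\<close> prefixes of length at least two.
\<close>

lemma num_variables_scheme1:
  assumes M: "{I \<in> monomials P. size I > 1} = {M}" and "size M > 2" and "finite (variables P)"
  shows "num_variables (rlt_relaxation (scheme1 P)) \<le> card (variables P) + 2 * (size M - 1)"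
proof -
  let ?prefixes = "(\<lambda>k. XQ (prefix_mset M k)) ` {2..size M}"
  let ?V = "X ` variables P \<union> ?prefixes"
  have "K = M" if "K \<in> monomials P" and "size K > 2" for K
    using M that by fastforce
  then have V: "variables (scheme1 P) \<subseteq> ?V"
    by (auto simp: scheme1_def)
  have "I = K" if "K \<in> J_sets (scheme1 P)" and "I \<subseteq># K" and "size I \<ge> 2" for I K
    using that J_sets_scheme1[OF M \<open>size M > 2\<close>] scheme1_products_size mset_subset_size[of I K]
    by (force simp: subset_mset.le_less)
  then have "{RLT I | I. size I \<ge> 2 \<and> (\<exists>K \<in> J_sets (scheme1 P). I \<subseteq># K)} \<subseteq> RLT ` scheme1_products M"
    using J_sets_scheme1[OF M \<open>size M > 2\<close>] by blast
  then have "lp_variables (rlt_relaxation (scheme1 P)) \<subseteq> Orig ` ?V \<union> RLT ` scheme1_products M"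
    unfolding rlt_relaxation_def linear_program.simps by (intro Un_mono image_mono V)
  then have "num_variables (rlt_relaxation (scheme1 P)) \<le> card (Orig ` ?V \<union> RLT ` scheme1_products M)"
    unfolding num_variables_def using assms(3) by (intro card_mono) (auto simp: finite_scheme1_products)
  also have "\<dots> \<le> card (Orig ` ?V) + card (RLT ` scheme1_products M)"
    by (rule card_Un_le)
  also have "\<dots> \<le> card ?V + card (scheme1_products M)"
    using assms(3) by (intro add_mono card_image_le) (auto simp: finite_scheme1_products)
  also have "card ?V \<le> card (X ` variables P) + card ?prefixes"
    by (rule card_Un_le)
  also have "\<dots> \<le> card (variables P) + card {2..size M}"
    using assms(3) by (intro add_mono card_image_le) auto
  finally show ?thesis
    using card_scheme1_products[of M] \<open>size M > 2\<close> by simp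
qed

lemma splits_of_pair:
  assumes "J\<^sub>1 + J\<^sub>2 = {#a, b#}"
  shows "(J\<^sub>1, J\<^sub>2) \<in> {({#}, {#a, b#}), ({#a#}, {#b#}), ({#b#}, {#a#}), ({#a, b#}, {#})}"
  using assms by (cases J\<^sub>1) (auto simp: add_eq_conv_ex union_is_single)

text \<open>
  Each J-set of size two has at most four splits. The set \<open>S\<close> may be larger than the set of
  J-sets, so that only candidates for J-sets have to be known.
\<close>

lemma card_bound_factor_constraints_pairs:
  fixes P :: "('v, 'c::comm_ring_1) problem"
  assumes "J_sets P \<subseteq> S" and "finite S" and "\<And>K. K \<in> S \<Longrightarrow> size K = 2"
  shows "finite (bound_factor_constraints P)" and "card (bound_factor_constraints P) \<le> 4 * card S"
proof -
  define B :: "'v multiset \<Rightarrow> ('v, 'c) constr set" where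
    "B K = {Geq (bound_factor P J\<^sub>1 J\<^sub>2) 0 | J\<^sub>1 J\<^sub>2. J\<^sub>1 + J\<^sub>2 = K}" for K
  have B: "finite (B K) \<and> card (B K) \<le> 4" if "K \<in> S" for K
  proof -
    have "size K = Suc 1"
      using assms(3) \<open>K \<in> S\<close> by simp
    then obtain a L where "K = add_mset a L"
      using size_eq_Suc_imp_eq_union by blast
    moreover from this \<open>size K = Suc 1\<close> obtain b where "L = {#b#}"
      using size_1_singleton_mset[of L] by auto
    ultimately have K: "K = {#a, b#}"
      by simp
    let ?splits = "[({#}, {#a, b#}), ({#a#}, {#b#}), ({#b#}, {#a#}), ({#a, b#}, {#})]"
    let ?L = "map (\<lambda>(J\<^sub>1, J\<^sub>2). Geq (bound_factor P J\<^sub>1 J\<^sub>2) (0 :: 'c)) ?splits"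
    have sub: "B K \<subseteq> set ?L"
      unfolding B_def K using splits_of_pair[of _ _ a b] by fastforce
    then have "card (B K) \<le> card (set ?L)"
      by (rule card_mono[OF List.finite_set])
    also have "\<dots> \<le> length ?L"
      by (rule card_length)
    finally show ?thesis
      using finite_subset[OF sub] by simp
  qed
  have sub: "bound_factor_constraints P \<subseteq> (\<Union>K \<in> S. B K)"
    using assms(1) by (auto simp: bound_factor_constraints_def B_def)
  moreover have fin: "finite (\<Union>K \<in> S. B K)"
    using assms(2) B by blast
  ultimately show "finite (bound_factor_constraints P)"
    by (rule finite_subset)
  have "card (bound_factor_constraints P) \<le> card (\<Union>K \<in> S. B K)"
    using sub fin by (rule card_mono[rotated])
  also have "\<dots> \<le> (\<Sum>K \<in> S. card (B K))"
    using assms(2) by (rule card_UN_le)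
  also have "\<dots> \<le> (\<Sum>K \<in> S. 4)"
    using B by (intro sum_mono) blast
  finally show "card (bound_factor_constraints P) \<le> 4 * card S"
    by simp
qed

text \<open>
  Each product contributes its defining equation and four bound factors, which gives the factor
  five.
\<close>

lemma num_constraints_scheme1:
  assumes M: "{I \<in> monomials P. size I > 1} = {M}" and "size M > 2" and "finite (constraints P)"
  shows "num_constraints (rlt_relaxation (scheme1 P)) \<le> card (constraints P) + 5 * (size M - 1)"
proof -
  let ?C = "map_relation quadrify id ` constraints P"
  let ?S = "scheme1_constraints M :: ('a quad_var, 'b) constr set"
  let ?B = "bound_factor_constraints (scheme1 P)"
  have "{K \<in> monomials P. size K > 2} = {M}"
    using M \<open>size M > 2\<close> by force
  then have C: "constraints (scheme1 P) = ?C \<union> ?S"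
    by (simp add: scheme1_def)
  note B = card_bound_factor_constraints_pairs[OF J_sets_scheme1[OF M \<open>size M > 2\<close>]
      finite_scheme1_products[of M] scheme1_products_size[of _ M]]
  have "num_constraints (rlt_relaxation (scheme1 P)) \<le> card (?C \<union> ?S \<union> ?B)"
    unfolding num_constraints_def rlt_relaxation_def linear_program.simps C
    using assms(3) B(1) \<open>size M > 2\<close> by (intro card_image_le) (simp add: card_scheme1_constraints)
  also have "\<dots> \<le> card ?C + card ?S + card ?B"
    by (meson add_mono card_Un_le le_refl le_trans)
  also have "\<dots> \<le> card (constraints P) + (size M - 1) + 4 * (size M - 1)"
    using assms(3) B(2) card_scheme1_products[of M] \<open>size M > 2\<close>
    by (intro add_mono card_image_le card_scheme1_constraints) auto
  finally show ?thesis
    by simp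
qed

section \<open>Comparison of the two relaxations\<close>

text \<open>
  The first inequality is the critical one: at \<open>m = 4\<close> it reads \<open>15 \<le> 16\<close>, and at \<open>m = 3\<close> it
  fails. It implies the second, since \<open>3 m - 1 \<le> 5 (m - 1)\<close> for \<open>m \<ge> 2\<close>.
\<close>

lemma exponential_bounds:
  fixes m :: nat
  assumes "m \<ge> 4"
  shows "5 * (m - 1) \<le> 2 ^ m" and "2 * (m - 1) \<le> 2 ^ m - (m + 1)"
proof -
  show le: "5 * (m - 1) \<le> 2 ^ m"
    using assms by (induction m rule: dec_induct) auto
  show "2 * (m - 1) \<le> 2 ^ m - (m + 1)"
    using le assms by simp
qed

theorem theorem3:
  fixes n R\<^sub>1 R :: nat
    and \<phi> :: "nat \<Rightarrow> (nat, real) poly"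
    and \<beta> l u :: "nat \<Rightarrow> real"
    and J :: "nat set"
    and PP :: "(nat, real) problem"
    and LP :: "(nat lp_var, nat symbolic) linear_program"
    and LP\<^sub>1 :: "(nat quad_var lp_var, nat symbolic) linear_program"
  assumes "R\<^sub>1 \<le> R"
    and "\<forall>r\<le>R. \<forall>I \<in> Poly_Mapping.keys (\<phi> r). set_mset I \<subseteq> {1..n}"
    and "\<forall>j\<in>{1..n}. 0 \<le> l j \<and> l j \<le> u j"
    and "PP = poly_problem n R\<^sub>1 R \<phi> \<beta> l u"
    and "{I \<in> monomials PP. size I > 1} = {mset_set J}"
    and "\<forall>j\<in>{1..n}. {#j#} \<in> monomials PP"
    and "LP = rlt_relaxation (with_symbolic_bounds PP)"
    and "LP\<^sub>1 = rlt_relaxation (scheme1 (with_symbolic_bounds PP))"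
    and "card J \<ge> 4"
  shows "num_variables LP\<^sub>1 \<le> num_variables LP \<and> num_constraints LP\<^sub>1 \<le> num_constraints LP"
proof -
  let ?P = "with_symbolic_bounds PP"
  have "finite J"
    using assms(9) by (auto intro: card_ge_0_finite)
  have nonlinear: "{I \<in> monomials ?P. size I > 1} = {mset_set J}"
    using assms(5) by (simp add: monomials_with_symbolic_bounds)
  have size: "size (mset_set J) = card J"
    by simp
  \<comment> \<open>A monomial strictly above \<open>J\<close> would be a second nonlinear one.\<close>
  have "\<not> mset_set J \<subset># I" if "I \<in> monomials PP" for I
  proof
    assume "mset_set J \<subset># I"
    moreover from this have "size I > 1"
      using mset_subset_size[of "mset_set J" I] size assms(9) by simp
    then have "I = mset_set J"
      using assms(5) that by blast
    ultimately show False
      by simp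
  qed
  then have J_sets: "J_sets PP = {mset_set J}"
    using assms(5) unfolding J_sets_def by blast
  then have J_sets_symbolic: "J_sets ?P = {mset_set J}"
    by (simp add: J_sets_def monomials_with_symbolic_bounds)
  have fin_V: "finite (variables ?P)"
    using assms(4) by (simp add: poly_problem_def with_symbolic_bounds_def)
  have "constraints PP = (\<lambda>r. Geq (\<phi> r) (\<beta> r)) ` {1..R\<^sub>1} \<union> (\<lambda>r. Eq (\<phi> r) (\<beta> r)) ` {R\<^sub>1 + 1..R}"
    using assms(4) by (auto simp: poly_problem_def)
  then have fin_C: "finite (constraints PP)" "finite (constraints ?P)"
    by (simp_all add: with_symbolic_bounds_def)
  have "num_variables LP\<^sub>1 \<le> card (variables ?P) + 2 * (card J - 1)"
    using num_variables_scheme1[OF nonlinear _ fin_V] assms(8,9) by simp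
  moreover have "num_variables LP = card (variables ?P) + (2 ^ card J - (card J + 1))"
    using num_variables_single_J_set[OF J_sets_symbolic \<open>finite J\<close> fin_V] assms(7) by simp
  moreover have "num_constraints LP\<^sub>1 \<le> card (constraints ?P) + 5 * (card J - 1)"
    using num_constraints_scheme1[OF nonlinear _ fin_C(2)] assms(8,9) by simp
  moreover have "num_constraints LP = card (constraints ?P) + 2 ^ card J"
    using num_constraints_single_J_set[OF J_sets \<open>finite J\<close> fin_C(1)] assms(7) by simp
  ultimately show ?thesis
    using exponential_bounds[OF assms(9)] by linarith
qed

end
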